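(* Let $\mathbb{H}$ be a complex Hilbert space and let $S,T\in\mathbb{B}(\mathbb{H})$. Then \[\begin{aligned} &\|S+T\|+\left|\int_0^1\left(\omega\left(\begin{bmatrix} O & (1-t)S+tT\\ tS^*+(1-t)T^* & O\end{bmatrix}\right)-\|(1-t)S+tT\|\right)dt\right|\\ &\le \int_0^1\left(\omega\left(\begin{bmatrix} O & (1-t)S+tT\\ tS^*+(1-t)T^* & O\end{bmatrix}\right)+\|(1-t)S+tT\|\right)dt\\ &\le \|S\|+\|T\|. \end{aligned}\]
   Context: $\mathbb{B}(\mathbb{H})$ denotes the $C^*$-algebra of all bounded linear operators on $\mathbb{H}$, $\|\cdot\|$ is the operator norm, $X^*$ is the adjoint of $X$, and $O$ is the zero operator. The numerical radius of an operator $X$ on a complex Hilbert space is $\omega(X)=\sup_{\|x\|=1}|\langle Xx,x\rangle|$. A $2\times 2$ block matrix with entries in $\mathbb{B}(\mathbb{H})$ is regarded as an operator on the Hilbert space direct sum $\mathbb{H}\oplus\mathbb{H}$. *)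

theory Defs
  imports "HOL-Analysis.Analysis"
begin

section \<open>Complex Hilbert spaces\<close>

class complex_vector = real_vector +
  fixes scaleC :: "complex \<Rightarrow> 'a \<Rightarrow> 'a" (infixr "*\<^sub>C" 75)
  assumes scaleC_add_right: "a *\<^sub>C (x + y) = a *\<^sub>C x + a *\<^sub>C y"
    and scaleC_add_left: "(a + b) *\<^sub>C x = a *\<^sub>C x + b *\<^sub>C x"
    and scaleC_scaleC: "a *\<^sub>C b *\<^sub>C x = (a * b) *\<^sub>C x"
    and scaleC_one: "1 *\<^sub>C x = x"
    and scaleR_scaleC: "r *\<^sub>R x = complex_of_real r *\<^sub>C x"

text \<open>
  The complex inner product is linear in the first argument. Identifying its real part with
  the real inner product of the superclass makes it positive definite and makes the norm the
  induced one; see \<open>cinner_self\<close> and \<open>norm_eq_sqrt_cinner\<close> below.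
\<close>

class complex_inner = complex_vector + real_inner +
  fixes cinner :: "'a \<Rightarrow> 'a \<Rightarrow> complex"
  assumes cinner_commute: "cinner x y = cnj (cinner y x)"
    and cinner_add_left: "cinner (x + y) z = cinner x z + cinner y z"
    and cinner_scaleC_left: "cinner (c *\<^sub>C x) y = c * cinner x y"
    and inner_eq_Re_cinner: "inner x y = Re (cinner x y)"

class complex_hilbert = complex_inner + complete_space
begin

subclass banach ..

end

lemma cinner_self: "cinner x x = complex_of_real ((norm x)\<^sup>2)"
proof -
  have "Im (cinner x x) = 0"
    using arg_cong[OF cinner_commute[of x x], of Im] by simp
  then show ?thesis
    by (simp add: complex_eq_iff power2_norm_eq_inner inner_eq_Re_cinner)
qed

lemma norm_eq_sqrt_cinner: "norm x = sqrt (cmod (cinner x x))"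
  by (simp add: cinner_self norm_power)

lemma cinner_eq_inner: "cinner x y = Complex (inner x y) (- inner (\<i> *\<^sub>C x) y)"
  by (simp add: complex_eq_iff inner_eq_Re_cinner cinner_scaleC_left)

instantiation complex :: complex_hilbert
begin

definition scaleC_complex :: "complex \<Rightarrow> complex \<Rightarrow> complex"
  where "scaleC_complex c x = c * x"

definition cinner_complex :: "complex \<Rightarrow> complex \<Rightarrow> complex"
  where "cinner_complex x y = x * cnj y"

instance
  by standard
    (simp_all add: scaleC_complex_def cinner_complex_def algebra_simps scaleR_conv_of_real inner_complex_def)

end

text \<open>The Hilbert space direct sum; its norm is the library norm on pairs (\<open>norm_Pair\<close>).\<close>

instantiation prod :: (complex_inner, complex_inner) complex_inner
begin

definition scaleC_prod :: "complex \<Rightarrow> 'a \<times> 'b \<Rightarrow> 'a \<times> 'b"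
  where "scaleC_prod c x = (c *\<^sub>C fst x, c *\<^sub>C snd x)"

definition cinner_prod :: "'a \<times> 'b \<Rightarrow> 'a \<times> 'b \<Rightarrow> complex"
  where "cinner_prod x y = cinner (fst x) (fst y) + cinner (snd x) (snd y)"

instance
proof
  show "cinner x y = cnj (cinner y x)" for x y :: "'a \<times> 'b"
    using cinner_commute[of "fst x" "fst y"] cinner_commute[of "snd x" "snd y"]
    by (simp add: cinner_prod_def)
qed (simp_all add: scaleC_prod_def cinner_prod_def scaleC_add_right scaleC_add_left scaleC_scaleC
      scaleC_one scaleR_prod_def scaleR_scaleC cinner_add_left cinner_scaleC_left inner_prod_def
      inner_eq_Re_cinner algebra_simps)

end

instance prod :: (complex_hilbert, complex_hilbert) complex_hilbert ..


section \<open>Bounded operators\<close>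

text \<open>
  The library type of bounded linear maps requires real linearity only, so the bounded
  operators on a complex space are cut out as its complex-linear elements. The norm and the
  vector space operations are those of the library type.
\<close>

definition bounded_operators :: "('a::complex_inner \<Rightarrow>\<^sub>L 'a) set"
  where "bounded_operators = {A. \<forall>c x. blinfun_apply A (c *\<^sub>C x) = c *\<^sub>C blinfun_apply A x}"

definition cadjoint :: "('a::complex_hilbert \<Rightarrow>\<^sub>L 'a) \<Rightarrow> 'a \<Rightarrow>\<^sub>L 'a"
  where "cadjoint A = (THE B. \<forall>x y. cinner (blinfun_apply A x) y = cinner x (blinfun_apply B y))"

text \<open>
  The case distinction concerns the zero space only, whose unit sphere is empty: the supremum,
  taken in the nonnegative reals, is then 0, but \<open>Sup {}\<close> is unspecified on type \<open>real\<close>.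
\<close>

definition numerical_radius :: "('a::complex_inner \<Rightarrow>\<^sub>L 'a) \<Rightarrow> real"
  where "numerical_radius A =
    (if {x::'a. norm x = 1} = {} then 0 else SUP x\<in>{x. norm x = 1}. cmod (cinner (A x) x))"

lift_definition block_operator ::
  "('a::complex_inner \<Rightarrow>\<^sub>L 'a) \<Rightarrow> ('a \<Rightarrow>\<^sub>L 'a) \<Rightarrow> ('a \<Rightarrow>\<^sub>L 'a) \<Rightarrow> ('a \<Rightarrow>\<^sub>L 'a) \<Rightarrow> ('a \<times> 'a) \<Rightarrow>\<^sub>L ('a \<times> 'a)"
  is "\<lambda>A B C D (x, y). (A x + B y, C x + D y)"
  unfolding case_prod_beta
  by (intro bounded_linear_Pair bounded_linear_add
      bounded_linear_compose[OF _ bounded_linear_fst] bounded_linear_compose[OF _ bounded_linear_snd])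

lemma block_operator_apply:
  "blinfun_apply (block_operator A B C D) (x, y) = (A x + B y, C x + D y)"
  by transfer simp

lemma block_operator_in_bounded_operators:
  assumes "A \<in> bounded_operators" "B \<in> bounded_operators"
    "C \<in> bounded_operators" "D \<in> bounded_operators"
  shows "block_operator A B C D \<in> bounded_operators"
  using assms by (auto simp: bounded_operators_def block_operator_apply scaleC_prod_def scaleC_add_right)


section \<open>Existence of the adjoint\<close>

lemma riesz_representation:
  fixes f :: "'a::{real_inner, complete_space} \<Rightarrow> real"
  assumes "bounded_linear f"
  shows "\<exists>v. \<forall>x. f x = inner x v"
proof -
  interpret f: bounded_linear f by fact
  define q where "q x = inner x x - 2 * f x" for x
  obtain K where K: "\<And>x. norm (f x) \<le> norm x * K"
    using f.nonneg_bounded by blast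
  have lower: "q x \<ge> - K\<^sup>2" for x
  proof -
    have "f x \<le> norm x * K" using K[of x] by simp
    moreover have "0 \<le> (norm x - K)\<^sup>2" by simp
    ultimately show ?thesis
      by (simp add: q_def power2_diff power2_norm_eq_inner algebra_simps)
  qed
  define m where "m = (INF x. q x)"
  have bdd: "bdd_below (range q)" using lower by (auto intro!: bdd_belowI)
  have m_le: "m \<le> q x" for x unfolding m_def using bdd by (rule cINF_lower) simp
  have "\<exists>x. q x < m + 1 / real (Suc n)" for n
    using cINF_less_iff[OF _ bdd, of "m + 1 / real (Suc n)"] by (simp add: m_def)
  then obtain X where X: "\<And>n. q (X n) < m + 1 / real (Suc n)" by metis
  have par: "(norm (x - y))\<^sup>2 \<le> 2 * (q x - m) + 2 * (q y - m)" for x y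
  proof -
    have "(norm (x - y))\<^sup>2 = 2 * q x + 2 * q y - 4 * q ((1/2) *\<^sub>R (x + y))"
      by (simp add: q_def power2_norm_eq_inner f.add f.scaleR inner_add inner_diff inner_commute[of y x]
          algebra_simps)
    with m_le[of "(1/2) *\<^sub>R (x + y)"] show ?thesis by simp
  qed
  have "Cauchy X"
  proof (rule metric_CauchyI)
    fix e :: real assume "e > 0"
    then obtain N where N: "inverse (real (Suc N)) < e\<^sup>2 / 4"
      using reals_Archimedean[of "e\<^sup>2 / 4"] by auto
    have small: "q (X n) - m < e\<^sup>2 / 4" if "n \<ge> N" for n
    proof -
      have "1 / real (Suc n) \<le> inverse (real (Suc N))"
        using that by (simp add: field_simps)
      with X[of n] N show ?thesis by linarith
    qed
    have "dist (X a) (X b) < e" if "a \<ge> N" "b \<ge> N" for a b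
    proof -
      have "(norm (X a - X b))\<^sup>2 < e\<^sup>2"
        using par[of "X a" "X b"] small[OF that(1)] small[OF that(2)] by (simp add: field_simps)
      then show ?thesis
        using \<open>e > 0\<close> by (simp add: dist_norm power2_less_imp_less)
    qed
    then show "\<exists>M. \<forall>a\<ge>M. \<forall>b\<ge>M. dist (X a) (X b) < e" by blast
  qed
  then obtain v where v: "X \<longlonglongrightarrow> v"
    using Cauchy_convergent_iff convergent_def by blast
  have "(\<lambda>n. q (X n)) \<longlonglongrightarrow> q v"
    unfolding q_def by (intro tendsto_intros v f.tendsto)
  moreover have "(\<lambda>n. m + 1 / real (Suc n)) \<longlonglongrightarrow> m + 0"
    by (intro tendsto_intros LIMSEQ_Suc[OF lim_1_over_n])
  ultimately have qv: "q v \<le> m"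
    using X by (intro LIMSEQ_le[of "\<lambda>n. q (X n)" "q v" "\<lambda>n. m + 1 / real (Suc n)" m])
      (auto intro: less_imp_le)
  have "f h = inner h v" for h
  proof -
    define d where "d = inner v h - f h"
    have quad: "0 \<le> 2 * t * d + t\<^sup>2 * inner h h" for t
    proof -
      have "q (v + t *\<^sub>R h) = q v + 2 * t * d + t\<^sup>2 * inner h h"
        by (simp add: q_def d_def f.add f.scaleR inner_add inner_commute[of h v] algebra_simps
            power2_eq_square)
      with m_le[of "v + t *\<^sub>R h"] qv show ?thesis by linarith
    qed
    have "d = 0"
    proof (rule ccontr)
      assume "d \<noteq> 0"
      define c where "c = inner h h + 1"
      have c: "c > 0" "inner h h < 2 * c"
        using inner_ge_zero[of h] by (simp_all add: c_def add_nonneg_pos del: inner_ge_zero)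
      have "2 * (- d / c) * d + (- d / c)\<^sup>2 * inner h h = (d\<^sup>2 / c\<^sup>2) * (inner h h - 2 * c)"
        using c by (simp add: field_simps power2_eq_square)
      moreover have "(d\<^sup>2 / c\<^sup>2) * (inner h h - 2 * c) < 0"
        using c \<open>d \<noteq> 0\<close> by (intro mult_pos_neg) auto
      ultimately show False using quad[of "- d / c"] by linarith
    qed
    then show ?thesis by (simp add: d_def inner_commute)
  qed
  then show ?thesis by blast
qed

lemma cadjoint_unique:
  assumes "\<And>x y. cinner (blinfun_apply A x) y = cinner x (blinfun_apply B y)"
  shows "cadjoint A = B"
  unfolding cadjoint_def
proof (rule the_equality)
  fix C assume C: "\<forall>x y. cinner (blinfun_apply A x) y = cinner x (blinfun_apply C y)"
  show "C = B"
  proof (rule blinfun_eqI)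
    fix y
    have "inner x (C y) = inner x (B y)" for x
      using C assms by (metis inner_eq_Re_cinner)
    then show "C y = B y" by (metis vector_eq_ldot)
  qed
qed (use assms in blast)

lemma cinner_cadjoint:
  assumes "A \<in> bounded_operators"
  shows "cinner (blinfun_apply A x) y = cinner x (blinfun_apply (cadjoint A) y)"
proof -
  have "\<exists>v. \<forall>x. inner (A x) y = inner x v" for y
    by (intro riesz_representation bounded_linear_inner_left_comp blinfun.bounded_linear_right)
  then obtain g where g: "\<And>x y. inner (A x) y = inner x (g y)" by metis
  have "bounded_linear g"
  proof (rule bounded_linear_intro[of _ "norm A"])
    show "g (x + y) = g x + g y" for x y
      by (rule vector_eq_ldot[THEN iffD1]) (simp add: g[symmetric] inner_add_right)
    show "g (r *\<^sub>R x) = r *\<^sub>R g x" for r x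
      by (rule vector_eq_ldot[THEN iffD1]) (simp add: g[symmetric])
    show "norm (g y) \<le> norm y * norm A" for y
    proof (cases "g y = 0")
      case False
      have "norm (g y) * norm (g y) = inner (A (g y)) y"
        by (simp add: g dot_square_norm power2_eq_square)
      also have "\<dots> \<le> norm (A (g y)) * norm y" by (rule norm_cauchy_schwarz)
      also have "\<dots> \<le> (norm A * norm (g y)) * norm y"
        by (intro mult_right_mono norm_blinfun) simp
      finally show ?thesis using False by (simp add: mult.assoc mult.left_commute mult.commute)
    qed simp
  qed
  then have B: "blinfun_apply (Blinfun g) = g" by (rule bounded_linear_Blinfun_apply)
  have adj: "cinner (A x) y = cinner x (Blinfun g y)" for x y
    using assms
    by (simp add: B cinner_eq_inner[of "A x"] cinner_eq_inner[of x] g[symmetric] bounded_operators_def)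
  show ?thesis using cadjoint_unique[OF adj] adj by simp
qed

end

theory Submission
  imports Defs
begin

text \<open>
  Write $A_t = (1-t)S + tT$, so that the lower left entry is $A_{1-t}^*$. The quadratic form of
  the block operator at $(x, y)$ is $\langle A_t y, x\rangle + \overline{\langle A_{1-t} y, x\rangle}$.
  Its modulus is at most $(\|A_t\| + \|A_{1-t}\|)\|x\|\|y\|$, and its real part is that of
  $\langle (S+T) y, x\rangle$; hence its numerical radius lies between $\|S+T\|/2$ and
  $(\|A_t\| + \|A_{1-t}\|)/2$. Since also $\|S+T\| \le \|A_t\| + \|A_{1-t}\| \le \|S\| + \|T\|$,
  integrating over $[0,1]$ and reflecting $t \mapsto 1-t$ gives all the inequalities.
\<close>

text \<open>The norm comes from the real inner product, so complex homogeneity has to be derived: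
  \<open>c\<close> is pulled out of both arguments of \<open>cinner\<close>, conjugated in the
  second.\<close>

lemma norm_scaleC: "norm (c *\<^sub>C x) = cmod c * norm (x::'a::complex_inner)"
proof -
  have "cinner (c *\<^sub>C x) (c *\<^sub>C x) = c * cnj (c * cinner x x)"
    by (metis cinner_commute cinner_scaleC_left)
  then have "cmod (cinner (c *\<^sub>C x) (c *\<^sub>C x)) = (cmod c)\<^sup>2 * cmod (cinner x x)"
    by (simp add: norm_mult power2_eq_square)
  then show ?thesis
    by (simp add: norm_eq_sqrt_cinner[of x] norm_eq_sqrt_cinner[of "c *\<^sub>C x"] real_sqrt_mult)
qed

lemma cmod_cinner_le: "cmod (cinner x y) \<le> norm x * norm (y::'a::complex_inner)"
proof (cases "cinner x y = 0")
  case False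
  \<comment> \<open>A unimodular factor that rotates \<open>cinner x y\<close> onto the nonnegative
    real axis, where the real Cauchy-Schwarz inequality applies.\<close>
  define u where "u = cnj (cinner x y) / cmod (cinner x y)"
  have "cmod u = 1"
    using False by (simp add: u_def norm_divide)
  have "u * cinner x y = cmod (cinner x y)"
    using False by (simp add: u_def complex_norm_square[symmetric] mult.commute power2_eq_square)
  then have "cmod (cinner x y) = inner (u *\<^sub>C x) y"
    by (simp add: inner_eq_Re_cinner cinner_scaleC_left)
  also have "\<dots> \<le> norm (u *\<^sub>C x) * norm y"
    by (rule norm_cauchy_schwarz)
  finally show ?thesis
    by (simp add: norm_scaleC \<open>cmod u = 1\<close>)
qed simp

lemma cinner_scaleR_left: "cinner (r *\<^sub>R x) y = of_real r * cinner x y"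
  by (simp add: scaleR_scaleC cinner_scaleC_left)

lemma cinner_add_right: "cinner x (y + z) = cinner x y + cinner x z"
  by (metis cinner_add_left cinner_commute complex_cnj_add)

lemma cinner_scaleR_right: "cinner x (r *\<^sub>R y) = of_real r * cinner x y"
  by (metis cinner_commute cinner_scaleR_left complex_cnj_complex_of_real complex_cnj_mult)

lemma cmod_cinner_blinfun_le:
  fixes X :: "'a::complex_inner \<Rightarrow>\<^sub>L 'a"
  shows "cmod (cinner (X x) y) \<le> norm X * norm x * norm y"
  by (rule order_trans[OF cmod_cinner_le mult_right_mono[OF norm_blinfun]]) simp

text \<open>The homogeneous bound spares later proofs the normalisation of vectors;
  \<open>0 \<le> c\<close> covers the zero space, where the numerical radius is 0 by
  convention.\<close>

lemma numerical_radius_least: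
  fixes X :: "'a::complex_inner \<Rightarrow>\<^sub>L 'a"
  assumes "0 \<le> c" and "\<And>z. cmod (cinner (X z) z) \<le> c * (norm z)\<^sup>2"
  shows "numerical_radius X \<le> c"
proof -
  have "cmod (cinner (X x) x) \<le> c" if "norm x = 1" for x
    using assms(2)[of x] that by simp
  then show ?thesis
    using assms(1) by (auto simp: numerical_radius_def intro!: cSUP_least)
qed

lemma cmod_cinner_le_numerical_radius:
  fixes X :: "'a::complex_inner \<Rightarrow>\<^sub>L 'a"
  shows "cmod (cinner (X z) z) \<le> numerical_radius X * (norm z)\<^sup>2"
proof (cases "z = 0")
  case False
  define u where "u = (1 / norm z) *\<^sub>R z"
  have u: "norm u = 1" "z = norm z *\<^sub>R u"
    using False by (simp_all add: u_def)
  \<comment> \<open>A real supremum is an upper bound only for a set bounded above; Cauchy-Schwarz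
    supplies the bound \<open>norm X\<close>.\<close>
  have bdd: "bdd_above ((\<lambda>x. cmod (cinner (X x) x)) ` {x. norm x = 1})"
  proof (rule bdd_aboveI2)
    fix x :: 'a
    assume "x \<in> {x. norm x = 1}"
    then show "cmod (cinner (X x) x) \<le> norm X"
      using cmod_cinner_blinfun_le[of X x x] by simp
  qed
  have "cmod (cinner (X u) u) \<le> numerical_radius X"
    using u(1) cSUP_upper[OF _ bdd, of u] by (auto simp: numerical_radius_def)
  moreover have "cmod (cinner (X z) z) = (norm z)\<^sup>2 * cmod (cinner (X u) u)"
    by (subst (1 2) u(2))
      (simp add: blinfun.scaleR_right cinner_scaleR_left cinner_scaleR_right norm_mult power2_eq_square)
  ultimately show ?thesis
    by (simp add: mult.commute[of "numerical_radius X"] mult_left_mono)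
qed (simp add: cmod_cinner_le[of 0 0, simplified])

lemma numerical_radius_nonneg:
  fixes X :: "'a::complex_inner \<Rightarrow>\<^sub>L 'a"
  shows "0 \<le> numerical_radius X"
proof (cases "\<exists>x::'a. norm x = 1")
  case True
  then obtain x :: 'a where "norm x = 1" by blast
  then show ?thesis
    using order_trans[OF norm_ge_zero cmod_cinner_le_numerical_radius[of X x]] by simp
qed (simp add: numerical_radius_def)

text \<open>The quadratic form is additive in the operator. Used in both orders, this makes the
  numerical radius 1-Lipschitz, hence continuous.\<close>

lemma numerical_radius_le_add_norm_diff:
  fixes X Y :: "'a::complex_inner \<Rightarrow>\<^sub>L 'a"
  shows "numerical_radius X \<le> numerical_radius Y + norm (X - Y)"
proof (rule numerical_radius_least)
  fix z
  have "cinner (X z) z = cinner (Y z) z + cinner ((X - Y) z) z"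
    by (simp add: cinner_add_left[symmetric] blinfun.diff_left)
  then have "cmod (cinner (X z) z) \<le> cmod (cinner (Y z) z) + cmod (cinner ((X - Y) z) z)"
    by (simp add: norm_triangle_ineq)
  then show "cmod (cinner (X z) z) \<le> (numerical_radius Y + norm (X - Y)) * (norm z)\<^sup>2"
    using cmod_cinner_le_numerical_radius[of Y z] cmod_cinner_blinfun_le[of "X - Y" z z]
    by (simp add: algebra_simps power2_eq_square)
qed (simp add: numerical_radius_nonneg)

lemma continuous_on_numerical_radius:
  "continuous_on A (numerical_radius :: ('a::complex_inner \<Rightarrow>\<^sub>L 'a) \<Rightarrow> real)"
proof -
  have "1-lipschitz_on A (numerical_radius :: ('a \<Rightarrow>\<^sub>L 'a) \<Rightarrow> real)"
  proof (rule lipschitz_onI)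
    fix X Y :: "'a \<Rightarrow>\<^sub>L 'a"
    show "dist (numerical_radius X) (numerical_radius Y) \<le> 1 * dist X Y"
      using numerical_radius_le_add_norm_diff[of X Y] numerical_radius_le_add_norm_diff[of Y X]
      by (simp add: dist_norm norm_minus_commute abs_le_iff)
  qed simp
  then show ?thesis by (rule lipschitz_on_continuous_on)
qed

lemma bounded_operators_combination:
  assumes "S \<in> bounded_operators" "T \<in> bounded_operators"
  shows "a *\<^sub>R S + b *\<^sub>R T \<in> bounded_operators"
  using assms
  by (simp add: bounded_operators_def blinfun.add_left blinfun.scaleR_left scaleC_add_right
      scaleR_scaleC scaleC_scaleC mult.commute)

text \<open>With real coefficients no conjugation appears, so the lower left entry of the theorem is
  itself the adjoint of a point on the segment from \<open>S\<close> to \<open>T\<close>.\<close>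

lemma cadjoint_combination:
  assumes "S \<in> bounded_operators" "T \<in> bounded_operators"
  shows "cadjoint (a *\<^sub>R S + b *\<^sub>R T) = a *\<^sub>R cadjoint S + b *\<^sub>R cadjoint T"
  by (rule cadjoint_unique)
    (simp add: blinfun.add_left blinfun.scaleR_left cinner_add_left cinner_add_right
      cinner_scaleR_left cinner_scaleR_right cinner_cadjoint assms)

text \<open>Moving the adjoint across brings both entries to the same pair \<open>y\<close>,
  \<open>x\<close>. The remaining conjugation changes neither modulus nor real part, on which the
  upper and lower bounds rest.\<close>

lemma cinner_off_diagonal:
  assumes "C \<in> bounded_operators"
  shows "cinner (block_operator 0 A (cadjoint C) 0 (x, y)) (x, y)
    = cinner (A y) x + cnj (cinner (C y) x)"
proof -
  have "cinner (cadjoint C x) y = cnj (cinner (C y) x)"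
    by (metis assms cinner_cadjoint cinner_commute)
  then show ?thesis
    by (simp add: block_operator_apply cinner_prod_def)
qed

lemma numerical_radius_off_diagonal_le:
  assumes "C \<in> bounded_operators"
  shows "numerical_radius (block_operator 0 A (cadjoint C) 0) \<le> (norm A + norm C) / 2"
proof (rule numerical_radius_least)
  fix z :: "'a \<times> 'a"
  obtain x y where z: "z = (x, y)" by fastforce
  have "cmod (cinner (block_operator 0 A (cadjoint C) 0 z) z)
      \<le> cmod (cinner (A y) x) + cmod (cinner (C y) x)"
    unfolding z cinner_off_diagonal[OF assms] by (rule norm_triangle_le) simp
  also have "\<dots> \<le> (norm A + norm C) * (norm x * norm y)"
    using cmod_cinner_blinfun_le[of A y x] cmod_cinner_blinfun_le[of C y x]
    by (simp add: algebra_simps)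
  \<comment> \<open>The factor 1/2 is the inequality of arithmetic and geometric means for the two
    components of \<open>z\<close>.\<close>
  also have "\<dots> \<le> (norm A + norm C) * ((norm z)\<^sup>2 / 2)"
    using sum_squares_bound[of "norm x" "norm y"]
    by (intro mult_left_mono) (simp_all add: z norm_Pair)
  finally show "cmod (cinner (block_operator 0 A (cadjoint C) 0 z) z)
      \<le> (norm A + norm C) / 2 * (norm z)\<^sup>2"
    by simp
qed simp

lemma numerical_radius_off_diagonal_ge:
  assumes "C \<in> bounded_operators"
  shows "norm (A + C) \<le> 2 * numerical_radius (block_operator 0 A (cadjoint C) 0)"
    (is "_ \<le> 2 * numerical_radius ?X")
proof (rule norm_blinfun_bound)
  fix y
  define v where "v = (A + C) y"
  show "norm ((A + C) y) \<le> 2 * numerical_radius ?X * norm y"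
  proof (cases "v = 0 \<or> y = 0")
    case False
    \<comment> \<open>Parallel to \<open>v\<close>, so that Cauchy-Schwarz is an equality, and as
      long as \<open>y\<close>, so that the squared norm of \<open>(x, y)\<close> is exactly twice
      that of \<open>y\<close>.\<close>
    define x where "x = (norm y / norm v) *\<^sub>R v"
    have x: "norm x = norm y"
      using False by (simp add: x_def)
    have "norm y * norm v = inner v x"
      using False by (simp add: x_def dot_square_norm power2_eq_square)
    \<comment> \<open>Taking real parts removes the conjugation, so the two terms add up to the form
      of \<open>A + C\<close>.\<close>
    also have "\<dots> = Re (cinner (?X (x, y)) (x, y))"
      by (simp add: cinner_off_diagonal[OF assms] v_def blinfun.add_left cinner_add_left
          inner_eq_Re_cinner)
    also have "\<dots> \<le> cmod (cinner (?X (x, y)) (x, y))"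
      by (rule complex_Re_le_cmod)
    also have "\<dots> \<le> numerical_radius ?X * (norm (x, y))\<^sup>2"
      by (rule cmod_cinner_le_numerical_radius)
    also have "\<dots> = norm y * (2 * numerical_radius ?X * norm y)"
      by (simp add: norm_Pair x power2_eq_square)
    finally show ?thesis
      using False by (simp add: v_def)
  qed (auto simp: v_def numerical_radius_nonneg)
qed (simp add: numerical_radius_nonneg)

text \<open>Exhibits a segment between two fixed operators, whose continuity in \<open>t\<close> is
  evident; this is what makes \<open>w\<close> integrable.\<close>

lemma block_operator_affine:
  "block_operator 0 ((1 - t) *\<^sub>R A + t *\<^sub>R B) (t *\<^sub>R C + (1 - t) *\<^sub>R D) 0
    = (1 - t) *\<^sub>R block_operator 0 A D 0 + t *\<^sub>R block_operator 0 B C 0"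
  by (rule blinfun_eqI)
    (auto simp: block_operator_apply blinfun.add_left blinfun.scaleR_left)

theorem theorem2p3:
  fixes S T :: "'a::complex_hilbert \<Rightarrow>\<^sub>L 'a"
  assumes "S \<in> bounded_operators" and "T \<in> bounded_operators"
  shows "norm (S + T)
      + \<bar>integral {0..1} (\<lambda>t::real.
          numerical_radius (block_operator
            0                                            ((1 - t) *\<^sub>R S + t *\<^sub>R T)
            (t *\<^sub>R cadjoint S + (1 - t) *\<^sub>R cadjoint T)   0)
          - norm ((1 - t) *\<^sub>R S + t *\<^sub>R T))\<bar>
    \<le> integral {0..1} (\<lambda>t::real.
          numerical_radius (block_operator
            0                                            ((1 - t) *\<^sub>R S + t *\<^sub>R T)
            (t *\<^sub>R cadjoint S + (1 - t) *\<^sub>R cadjoint T)   0)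
          + norm ((1 - t) *\<^sub>R S + t *\<^sub>R T))
   \<and> integral {0..1} (\<lambda>t::real.
          numerical_radius (block_operator
            0                                            ((1 - t) *\<^sub>R S + t *\<^sub>R T)
            (t *\<^sub>R cadjoint S + (1 - t) *\<^sub>R cadjoint T)   0)
          + norm ((1 - t) *\<^sub>R S + t *\<^sub>R T))
    \<le> norm S + norm T"
proof -
  define A where "A t = (1 - t) *\<^sub>R S + t *\<^sub>R T" for t :: real
  define w where "w t = numerical_radius (block_operator 0 (A t)
    (t *\<^sub>R cadjoint S + (1 - t) *\<^sub>R cadjoint T) 0)" for t
  have w_eq: "w t = numerical_radius (block_operator 0 (A t) (cadjoint (A (1 - t))) 0)" for t
    using cadjoint_combination[OF assms, of t "1 - t"] by (simp add: w_def A_def)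
  have A_bounded: "A t \<in> bounded_operators" for t
    unfolding A_def by (rule bounded_operators_combination[OF assms])
  have A_sum: "A t + A (1 - t) = S + T" for t
    by (simp add: A_def algebra_simps)
  have w_le: "w t \<le> (norm (A t) + norm (A (1 - t))) / 2" for t
    unfolding w_eq by (rule numerical_radius_off_diagonal_le[OF A_bounded])
  have w_ge: "norm (S + T) / 2 \<le> w t" for t
    using numerical_radius_off_diagonal_ge[OF A_bounded, of "A t" "1 - t"]
    by (simp add: w_eq A_sum)
  have A_ge: "norm (S + T) \<le> norm (A t) + norm (A (1 - t))" for t
    using norm_triangle_ineq[of "A t" "A (1 - t)"] by (simp add: A_sum)
  have A_le: "norm (A t) + norm (A (1 - t)) \<le> norm S + norm T" if "t \<in> {0..1}" for t
  proof -
    \<comment> \<open>Convexity of the norm along the segment; adding the cases \<open>t\<close> and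
      \<open>1 - t\<close> makes the weights sum to 1.\<close>
    have "norm (A s) \<le> (1 - s) * norm S + s * norm T" if "s \<in> {0..1}" for s
      unfolding A_def using that by (intro norm_triangle_le) simp
    from this[of t] this[of "1 - t"] that show ?thesis
      by (simp add: algebra_simps)
  qed
  have "continuous_on {0..1} w"
    unfolding w_def A_def block_operator_affine
    by (rule continuous_on_compose2[OF continuous_on_numerical_radius[of UNIV]])
      (auto intro!: continuous_intros)
  then have w_int: "w integrable_on {0..1}"
    by (rule integrable_continuous_interval)
  have "continuous_on {0..1} (\<lambda>t. norm (A t))"
    unfolding A_def by (intro continuous_intros)
  then have A_int: "(\<lambda>t. norm (A t)) integrable_on {0..1}"
    by (rule integrable_continuous_interval)
  define I where "I = integral {0..1} (\<lambda>t. norm (A t))"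
  have "((\<lambda>t. norm (A t)) has_integral I) (cbox 0 1)"
    using A_int by (simp add: I_def has_integral_integral)
  \<comment> \<open>The substitution with slope -1 and offset 1 maps the unit interval onto itself,
    so reflection leaves \<open>I\<close> unchanged.\<close>
  from has_integral_affinity[OF this, of "- 1" 1]
  have "((\<lambda>t. norm (A (1 - t))) has_integral I) {0..1}"
    by (simp add: image_affinity_cbox)
  then have sum_int: "((\<lambda>t. norm (A t) + norm (A (1 - t))) has_integral (I + I)) {0..1}"
    using A_int by (intro has_integral_add) (simp_all add: I_def has_integral_integral)
  have const_int: "((\<lambda>t. c) has_integral c) {0..1::real}" for c :: real
    using has_integral_const_real[of c 0 1] by simp
  have "norm (S + T) \<le> I + I"
    by (rule has_integral_le[OF const_int sum_int]) (rule A_ge)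
  moreover have "I + I \<le> norm S + norm T"
    by (rule has_integral_le[OF sum_int const_int]) (rule A_le)
  moreover have "integral {0..1} w \<le> I"
    using has_integral_le[OF integrable_integral[OF w_int] has_integral_divide[OF sum_int, of 2]]
      w_le by simp
  moreover have "norm (S + T) / 2 \<le> integral {0..1} w"
    by (rule has_integral_le[OF const_int integrable_integral[OF w_int]]) (rule w_ge)
  \<comment> \<open>Write \<open>W\<close> for the integral of \<open>w\<close>. As
    \<open>W \<le> I\<close>, the absolute value is \<open>I - W\<close>, so the first inequality
    amounts to \<open>norm (S + T) \<le> 2 * W\<close>; the second follows from
    \<open>W + I \<le> I + I\<close>.\<close>
  ultimately show ?thesis
    unfolding A_def[symmetric] w_def[symmetric] integral_add[OF w_int A_int]
      integral_diff[OF w_int A_int] I_def[symmetric]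
    by linarith
qed

end
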